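(* Let $Q_0\in O(n)$ and let $Q(t)$, $t\ge 0$, be the solution with $Q(0)=Q_0$ of either system (I) or system (II) described in the context (with an arbitrary smooth field $S$ of skew-symmetric matrices on $O(n)$). Then there exists $Q^*\in E$ such that $$\lim_{t\to\infty}Q(t)=Q^* .$$
   Context: $A=\mathrm{diag}\{\lambda_1,\dots,\lambda_n\}\in\mathbb{R}^{n\times n}$ with $\lambda_1>\lambda_2>\dots>\lambda_n>0$, and $N=\mathrm{diag}\{\mu_1,\dots,\mu_n\}\in\mathbb{R}^{n\times n}$ with $\mu_1>\mu_2>\dots>\mu_n$. $O(n)=\{Q\in\mathbb{R}^{n\times n}: Q^TQ=I_n\}$. $E_j$ denotes the $n\times n$ matrix with entry $1$ at position $(j,j)$ and $0$ elsewhere. For $Q\in O(n)$ define $$F(Q)=Q\sum_{j=1}^n\sum_{k=1}^{j-1}\left(E_jQ^TAQE_k-E_kQ^TAQE_j\right).$$ $E=\{\mathrm{diag}\{\varepsilon_1,\dots,\varepsilon_n\}P:\ \varepsilon_i=\pm1,\ P \text{ an } n\times n \text{ permutation matrix}\}$. $S:O(n)\to\mathbb{R}^{n\times n}$ is an arbitrary smooth map with $S(Q)+S(Q)^T=0$ for all $Q$. System (I) (Landau-Lifshitz-Gilbert (LLG) equation for the energy $-\mathrm{tr}(NQ^TAQ)$, for a metric on $O(n)\setminus E$ with respect to which the gradient of $\mathrm{tr}(NQ^TAQ)$ is $F$): $$\dot Q=2\,\mathrm{tr}\big(NQ^TAF(Q)\big)\,QS(Q)-2\,\mathrm{tr}\big(NQ^TAQS(Q)\big)\,F(Q)+F(Q).$$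 System (II) (the same construction for the Euclidean metric $\langle X,Y\rangle_F=\mathrm{tr}(X^TY)$): with $H(Q)=AQN-QNQ^TAQ$ (the Euclidean gradient of $\mathrm{tr}(NQ^TAQ)$ on $O(n)$), $$\dot Q=\|H(Q)\|_F^2\,QS(Q)-\langle H(Q),QS(Q)\rangle_F\,H(Q)+H(Q).$$ *)

theory Defs
  imports "HOL-Analysis.Analysis"
begin

text \<open>
  Matrices are indexed by a finite linearly ordered type \<open>'n\<close>, which plays the role of
  \<open>{1, ..., n}\<close> with its usual order; the order enters through the ordering of the
  eigenvalues and through the range of the inner sum in \<open>F_field\<close>.
\<close>

type_synonym 'n sqmat = "real^'n^'n"

definition diag_mat :: "('n::finite \<Rightarrow> real) \<Rightarrow> 'n sqmat" where
  "diag_mat d = (\<chi> i j. if i = j then d i else 0)"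

definition E_unit :: "'n::finite \<Rightarrow> 'n sqmat" where
  "E_unit j = (\<chi> i k. if i = j \<and> k = j then 1 else 0)"

definition orth_group :: "('n::finite sqmat) set" where
  "orth_group = {Q. orthogonal_matrix Q}"

definition perm_mat :: "('n::finite \<Rightarrow> 'n) \<Rightarrow> 'n sqmat" where
  "perm_mat p = (\<chi> i j. if j = p i then 1 else 0)"

definition signed_perm_mats :: "('n::finite sqmat) set" where
  "signed_perm_mats =
     {diag_mat e ** perm_mat p | e p. (\<forall>i. e i = 1 \<or> e i = - 1) \<and> p permutes UNIV}"

definition frob_inner :: "'n::finite sqmat \<Rightarrow> 'n sqmat \<Rightarrow> real" where
  "frob_inner X Y = trace (transpose X ** Y)"

definition frob_norm :: "'n::finite sqmat \<Rightarrow> real" where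
  "frob_norm X = sqrt (frob_inner X X)"

text \<open>
  \<open>C_on k U f\<close> is meant for open \<open>U\<close>: \<open>f\<close> is \<open>k\<close> times continuously differentiable on \<open>U\<close>.
  Continuity of the derivative is expressed through all directional derivatives, which is
  equivalent to continuity in operator norm since the domain is finite-dimensional.
\<close>

primrec C_on :: "nat \<Rightarrow> 'a::euclidean_space set \<Rightarrow> ('a \<Rightarrow> 'b::real_normed_vector) \<Rightarrow> bool" where
  "C_on 0 U f \<longleftrightarrow> continuous_on U f"
| "C_on (Suc k) U f \<longleftrightarrow>
     (\<forall>x\<in>U. f differentiable (at x)) \<and>
     (\<forall>v. C_on k U (\<lambda>x. frechet_derivative f (at x) v))"

text \<open>
  Smoothness on a subset that need not be open, such as an embedded submanifold: \<open>f\<close> has a local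
  smooth extension to an open neighbourhood of each point. Only the values of \<open>f\<close> on \<open>M\<close> matter.
\<close>

definition smooth_map_on :: "'a::euclidean_space set \<Rightarrow> ('a \<Rightarrow> 'b::real_normed_vector) \<Rightarrow> bool" where
  "smooth_map_on M f \<longleftrightarrow>
     (\<forall>x\<in>M. \<exists>U g. open U \<and> x \<in> U \<and> (\<forall>k. C_on k U g) \<and> (\<forall>y\<in>U \<inter> M. g y = f y))"

definition F_field ::
  "'n::{finite,linorder} sqmat \<Rightarrow> 'n sqmat \<Rightarrow> 'n sqmat" where
  "F_field A Q =
     Q ** (\<Sum>j\<in>UNIV. \<Sum>k\<in>{..<j}.
       (E_unit j ** transpose Q ** A ** Q ** E_unit k - E_unit k ** transpose Q ** A ** Q ** E_unit j))"

definition H_field :: "'n::finite sqmat \<Rightarrow> 'n sqmat \<Rightarrow> 'n sqmat \<Rightarrow> 'n sqmat" where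
  "H_field A N Q = A ** Q ** N - Q ** N ** transpose Q ** A ** Q"

definition system_I ::
  "'n::{finite,linorder} sqmat \<Rightarrow> 'n sqmat \<Rightarrow>
   ('n sqmat \<Rightarrow> 'n sqmat) \<Rightarrow> 'n sqmat \<Rightarrow> 'n sqmat" where
  "system_I A N S Q =
     (2 * trace (N ** transpose Q ** A ** F_field A Q)) *\<^sub>R (Q ** S Q)
     - (2 * trace (N ** transpose Q ** A ** Q ** S Q)) *\<^sub>R F_field A Q
     + F_field A Q"

definition system_II ::
  "'n::finite sqmat \<Rightarrow> 'n sqmat \<Rightarrow> ('n sqmat \<Rightarrow> 'n sqmat) \<Rightarrow> 'n sqmat \<Rightarrow> 'n sqmat" where
  "system_II A N S Q =
     (frob_norm (H_field A N Q))\<^sup>2 *\<^sub>R (Q ** S Q)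
     - frob_inner (H_field A N Q) (Q ** S Q) *\<^sub>R H_field A N Q
     + H_field A N Q"

text \<open>
  Forward solution of an autonomous ODE with state space \<open>M\<close>; the derivative at time 0 is
  one-sided. The vector field is only meaningful on \<open>M\<close>, so remaining in \<open>M\<close> is part of the notion.
\<close>

definition is_solution ::
  "'a::real_normed_vector set \<Rightarrow> ('a \<Rightarrow> 'a) \<Rightarrow> 'a \<Rightarrow> (real \<Rightarrow> 'a) \<Rightarrow> bool" where
  "is_solution M V x0 x \<longleftrightarrow>
     x 0 = x0 \<and>
     (\<forall>t\<ge>0. x t \<in> M \<and> (x has_vector_derivative V (x t)) (at t within {0..}))"

end

theory Submission
  imports Defs
begin

text \<open>
  On tangent vectors \<open>Q \<Omega>\<close> with \<open>\<Omega>\<close> skew-symmetric, the derivative of the energy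
  \<open>tr(N Q\<^sup>T A Q)\<close> is \<open>D Q (Q \<Omega>)\<close>, where \<open>D Q X = 2 \<langle>A Q N, X\<rangle>\<close>. With \<open>B = Q\<^sup>T A Q\<close>, both \<open>F\<close> and \<open>H\<close>
  are of the form \<open>G = Q (\<phi>(\<mu>\<^sub>j - \<mu>\<^sub>i) B\<^sub>i\<^sub>j)\<close>, with \<open>\<phi> = sgn\<close> and \<open>\<phi> = id\<close> respectively, and both
  systems read \<open>Q' = D(G) Q S - D(Q S) G + G\<close>. Hence the energy increases along solutions at rate
  \<open>D(G) = \<Sum> (\<mu>\<^sub>j - \<mu>\<^sub>i) \<phi>(\<mu>\<^sub>j - \<mu>\<^sub>i) B\<^sub>i\<^sub>j\<^sup>2\<close>, which vanishes only if \<open>B\<close> is diagonal, that is, at signed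
  permutation matrices. Energy and velocity are bounded on the compact group, so this rate tends to
  \<open>0\<close> (Barbalat); as its zeros are finitely many, the connected orbit approaches just one of them.
\<close>

section \<open>Convergence of gradient-like trajectories in a compact set\<close>

lemma solution_lipschitz:
  fixes x :: "real \<Rightarrow> 'a::real_normed_vector"
  assumes sol: "is_solution M V x0 x" and bnd: "\<And>y. y \<in> M \<Longrightarrow> norm (V y) \<le> L"
    and "s \<ge> 0" "t \<ge> 0"
  shows "dist (x s) (x t) \<le> L * dist s t"
  unfolding dist_norm
proof (rule differentiable_bound[where S = "{0..}" and f' = "\<lambda>t h. h *\<^sub>R V (x t)"])
  fix r :: real assume "r \<in> {0..}"
  then have r: "x r \<in> M" "(x has_vector_derivative V (x r)) (at r within {0..})"
    using sol by (auto simp: is_solution_def)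
  show "(x has_derivative (\<lambda>h. h *\<^sub>R V (x r))) (at r within {0..})"
    using r(2) by (simp add: has_vector_derivative_def)
  show "onorm (\<lambda>h. h *\<^sub>R V (x r)) \<le> L"
    by (rule onorm_le) (use bnd[OF r(1)] in \<open>simp add: mult.commute[of L] mult_left_mono\<close>)
qed (use assms in auto)

text \<open>Since \<open>h\<close> is increasing and bounded, its late increments over windows of
  length \<open>d\<close> are small. By the mean value theorem \<open>k\<close> is then small
  somewhere in each such window, and uniform continuity carries this back to the left end of the
  window.\<close>

lemma barbalat_increasing:
  fixes h k :: "real \<Rightarrow> real"
  assumes der: "\<And>t. t \<ge> 0 \<Longrightarrow> (h has_real_derivative k t) (at t within {0..})"
    and nonneg: "\<And>t. t \<ge> 0 \<Longrightarrow> 0 \<le> k t"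
    and bdd: "bdd_above (h ` {0..})"
    and unif: "uniformly_continuous_on {0..} k"
  shows "(k \<longlongrightarrow> 0) at_top"
proof (rule tendstoI)
  fix e :: real assume e: "e > 0"
  have mvt: "\<exists>\<xi>\<in>{a<..<b}. h b - h a = (b - a) * k \<xi>" if "0 \<le> a" "a < b" for a b
  proof -
    have "\<exists>\<xi>\<in>{a<..<b}. h b - h a = (\<lambda>d. k \<xi> * d) (b - a)"
    proof (rule mvt_simple[OF \<open>a < b\<close>])
      fix r assume "a \<le> r" "r \<le> b"
      then show "(h has_derivative (*) (k r)) (at r within {a..b})"
        using has_field_derivative_subset[OF der[of r]] that
        by (force simp: has_field_derivative_def)
    qed
    then show ?thesis by (auto simp: mult.commute)
  qed
  have mono: "h a \<le> h b" if "0 \<le> a" "a \<le> b" for a b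
  proof (cases "a = b")
    case False
    then have "a < b" using that by simp
    then obtain \<xi> where "\<xi> \<in> {a<..<b}" "h b - h a = (b - a) * k \<xi>"
      using mvt \<open>0 \<le> a\<close> by blast
    then show ?thesis using nonneg[of \<xi>] that by (smt (verit) greaterThanLessThan_iff mult_nonneg_nonneg)
  qed simp
  obtain d where d: "d > 0" "\<And>s t. \<lbrakk>s \<ge> 0; t \<ge> 0; dist s t < d\<rbrakk> \<Longrightarrow> dist (k s) (k t) < e / 2"
    using unif e unfolding uniformly_continuous_on_def by (metis atLeast_iff half_gt_zero)
  define s where "s = Sup (h ` {0..})"
  have le_s: "h t \<le> s" if "t \<ge> 0" for t
    unfolding s_def using bdd that by (intro cSup_upper) auto
  \<comment> \<open>The gap \<open>d * (e / 2)\<close> is the growth that a rate of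
    \<open>e / 2\<close> would produce on a window of length \<open>d\<close>. The other half of
    \<open>e\<close> is spent on the oscillation of \<open>k\<close> within the window.\<close>
  have "s - d * (e / 2) < s" using d e by simp
  then obtain T where T: "T \<ge> 0" "s - d * (e / 2) < h T"
    unfolding s_def by (elim less_cSupE) auto
  show "\<forall>\<^sub>F t in at_top. dist (k t) 0 < e"
    using eventually_ge_at_top[of T]
  proof eventually_elim
    case (elim t)
    then have t: "t \<ge> 0" "h t > s - d * (e / 2)" using T mono[of T t] by auto
    obtain \<xi> where xi: "t < \<xi>" "\<xi> < t + d" "h (t + d) - h t = d * k \<xi>"
      using mvt[of t "t + d"] t d by auto
    have "d * k \<xi> < d * (e / 2)" using xi(3) t(2) le_s[of "t + d"] t(1) d(1) by linarith
    then have "k \<xi> < e / 2" using d(1) by (simp only: mult_less_cancel_left_pos)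
    moreover have "dist (k t) (k \<xi>) < e / 2" using d(2)[of t \<xi>] xi t by (auto simp: dist_real_def)
    ultimately show ?case using nonneg[OF t(1)] unfolding dist_real_def by linarith
  qed
qed

text \<open>A ball that meets \<open>C\<close> and the union of all the other balls are disjoint
  open sets covering \<open>C\<close>, so connectedness excludes the others.\<close>

lemma connected_subset_one_ball:
  fixes C :: "'a::metric_space set"
  assumes "connected C" "C \<noteq> {}" and sub: "C \<subseteq> (\<Union>z\<in>Z. ball z r)"
    and disj: "\<And>y z. \<lbrakk>y \<in> Z; z \<in> Z; y \<noteq> z\<rbrakk> \<Longrightarrow> ball y r \<inter> ball z r = {}"
  shows "\<exists>z\<in>Z. C \<subseteq> ball z r"
proof -
  obtain c z where cz: "c \<in> C" "z \<in> Z" "c \<in> ball z r" using assms by blast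
  let ?U = "\<Union>y\<in>Z - {z}. ball y r"
  have "ball z r \<inter> C = {} \<or> ?U \<inter> C = {}"
  proof (rule connectedD[OF \<open>connected C\<close>])
    show "ball z r \<inter> ?U \<inter> C = {}" using disj cz by blast
  qed (use sub in auto)
  then show ?thesis using cz sub by blast
qed

text \<open>Outside small balls around the zeros, \<open>\<bar>g\<bar>\<close> is bounded below by
  compactness, so a tail of \<open>x\<close> lies in the balls. Being connected, the tail stays in a
  single one, and shrinking the radius gives convergence to its centre.\<close>

lemma tendsto_isolated_zero:
  fixes x :: "real \<Rightarrow> 'a::metric_space" and g :: "'a \<Rightarrow> real"
  assumes M: "compact M" and inM: "\<And>t. t \<ge> 0 \<Longrightarrow> x t \<in> M"
    and x: "continuous_on {0..} x" and g: "continuous_on M g"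
    and fin: "finite {z \<in> M. g z = 0}" and lim: "((\<lambda>t. g (x t)) \<longlongrightarrow> 0) at_top"
  shows "\<exists>z\<in>M. g z = 0 \<and> (x \<longlongrightarrow> z) at_top"
proof -
  define Z where "Z = {z \<in> M. g z = 0}"
  have near: "\<exists>T\<ge>0. \<forall>t\<ge>T. x t \<in> (\<Union>z\<in>Z. ball z r)" if "r > 0" for r
  proof -
    define K where "K = M - (\<Union>z\<in>Z. ball z r)"
    have K: "compact K" unfolding K_def by (rule compact_diff[OF M]) auto
    have pos: "\<bar>g y\<bar> > 0" if "y \<in> K" for y using that \<open>r > 0\<close> by (force simp: K_def Z_def)
    \<comment> \<open>If the balls cover \<open>M\<close>, there is no minimum to take and any
      positive value, here 1, will do.\<close>
    have "\<exists>m>0. \<forall>y\<in>K. m \<le> \<bar>g y\<bar>"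
    proof (cases "K = {}")
      case False
      have "continuous_on K (\<lambda>y. \<bar>g y\<bar>)"
        by (intro continuous_intros continuous_on_subset[OF g]) (auto simp: K_def)
      from continuous_attains_inf[OF K False this] pos show ?thesis by blast
    qed (auto intro: exI[of _ 1])
    then obtain m where m: "m > 0" "\<And>y. y \<in> K \<Longrightarrow> m \<le> \<bar>g y\<bar>" by blast
    have "\<forall>\<^sub>F t in at_top. dist (g (x t)) 0 < m" using lim m(1) by (rule tendstoD)
    then obtain T where "\<And>t. t \<ge> T \<Longrightarrow> \<bar>g (x t)\<bar> < m" by (auto simp: eventually_at_top_linorder)
    then have "x t \<in> (\<Union>z\<in>Z. ball z r)" if "t \<ge> max 0 T" for t
      using that inM[of t] m(2)[of "x t"] unfolding K_def by force
    then show ?thesis by (intro exI[of _ "max 0 T"]) auto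
  qed
  have "\<exists>r>0. \<forall>y\<in>Z. \<forall>z\<in>Z. y \<noteq> z \<longrightarrow> 2 * r \<le> dist y z"
  proof -
    \<comment> \<open>The inserted 1 keeps the set nonempty when \<open>Z\<close> has at most one
      point; half of the minimum then serves as a radius for disjoint balls.\<close>
    let ?D = "insert 1 ((\<lambda>(y, z). dist y z) ` {(y, z). y \<in> Z \<and> z \<in> Z \<and> y \<noteq> z})"
    have D: "finite ?D"
      by (rule finite.insertI, rule finite_imageI, rule finite_subset[of _ "Z \<times> Z"])
        (use fin in \<open>auto simp: Z_def\<close>)
    have "Min ?D > 0" using D by (subst Min_gr_iff) auto
    moreover have "Min ?D \<le> dist y z" if "y \<in> Z" "z \<in> Z" "y \<noteq> z" for y z
      by (rule Min_le[OF D]) (use that in auto)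
    ultimately show ?thesis by (intro exI[of _ "Min ?D / 2"]) auto
  qed
  then obtain r0 where r0: "r0 > 0"
    and sep: "\<And>y z. \<lbrakk>y \<in> Z; z \<in> Z; y \<noteq> z\<rbrakk> \<Longrightarrow> 2 * r0 \<le> dist y z" by blast
  have disj: "ball y r0 \<inter> ball z r0 = {}" if "y \<in> Z" "z \<in> Z" "y \<noteq> z" for y z
    using sep[OF that] by (rule_tac disjoint_ballI) simp
  obtain T where T: "T \<ge> 0" "\<And>t. t \<ge> T \<Longrightarrow> x t \<in> (\<Union>z\<in>Z. ball z r0)"
    using near[OF r0] by blast
  have "\<exists>z\<in>Z. x ` {T..} \<subseteq> ball z r0"
  proof (rule connected_subset_one_ball)
    show "connected (x ` {T..})"
      by (intro connected_continuous_image continuous_on_subset[OF x]) (use T in auto)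
  qed (use T disj in auto)
  then obtain z where z: "z \<in> Z" "\<And>t. t \<ge> T \<Longrightarrow> x t \<in> ball z r0"
    by (auto simp: image_subset_iff)
  have "(x \<longlongrightarrow> z) at_top"
  proof (rule tendstoI)
    fix e :: real assume "e > 0"
    then obtain T' where T': "\<And>t. t \<ge> T' \<Longrightarrow> x t \<in> (\<Union>z\<in>Z. ball z (min e r0))"
      using near[of "min e r0"] r0 by auto
    show "\<forall>\<^sub>F t in at_top. dist (x t) z < e"
      using eventually_ge_at_top[of "max T T'"]
    proof eventually_elim
      case (elim t)
      then obtain y where y: "y \<in> Z" "x t \<in> ball y (min e r0)" using T'[of t] by auto
      \<comment> \<open>The smaller ball around \<open>y\<close> lies in \<open>ball y r0\<close>,
        which is disjoint from \<open>ball z r0\<close> unless the centres agree.\<close>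
      then have "y = z" using disj[of y z] z elim by force
      then show ?case using y by (simp add: dist_commute)
    qed
  qed
  then show ?thesis using z by (auto simp: Z_def)
qed

text \<open>Compactness bounds \<open>V\<close>, so \<open>x\<close> is Lipschitz, and it makes
  \<open>g\<close> uniformly continuous. The composed rate \<open>g (x t)\<close> is therefore
  uniformly continuous, while the energy \<open>f (x t)\<close> is bounded: this is the input for
  \<open>barbalat_increasing\<close>.\<close>

lemma gradient_like_solution_tendsto:
  fixes x :: "real \<Rightarrow> 'a::real_normed_vector" and f g :: "'a \<Rightarrow> real"
  assumes M: "compact M" and sol: "is_solution M V x0 x" and V: "continuous_on M V"
    and f: "continuous_on M f" and g: "continuous_on M g"
    and der: "\<And>t. t \<ge> 0 \<Longrightarrow> ((\<lambda>t. f (x t)) has_real_derivative g (x t)) (at t within {0..})"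
    and nonneg: "\<And>y. y \<in> M \<Longrightarrow> 0 \<le> g y"
    and fin: "finite {z \<in> M. g z = 0}"
  shows "\<exists>z\<in>M. g z = 0 \<and> (x \<longlongrightarrow> z) at_top"
proof (rule tendsto_isolated_zero[OF M _ _ g fin])
  show inM: "x t \<in> M" if "t \<ge> 0" for t using sol that by (auto simp: is_solution_def)
  obtain L where L: "\<And>y. y \<in> M \<Longrightarrow> norm (V y) \<le> L"
    using compact_imp_bounded[OF compact_continuous_image[OF V M]] by (auto simp: bounded_iff)
  have "L-lipschitz_on {0..} x"
  proof (rule lipschitz_onI)
    show "0 \<le> L" using norm_ge_zero order_trans[OF _ L[OF inM[of 0]]] by blast
  qed (use solution_lipschitz[OF sol L] in auto)
  then have x: "uniformly_continuous_on {0..} x" by (rule lipschitz_on_uniformly_continuous)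
  then show "continuous_on {0..} x" by (rule uniformly_continuous_imp_continuous)
  show "((\<lambda>t. g (x t)) \<longlongrightarrow> 0) at_top"
  proof (rule barbalat_increasing[OF der])
    have "bdd_above (f ` M)"
      by (intro bounded_imp_bdd_above compact_imp_bounded compact_continuous_image f M)
    then show "bdd_above ((\<lambda>t. f (x t)) ` {0..})"
      by (rule bdd_above_mono) (use inM in auto)
    have "x ` {0..} \<subseteq> M" using inM by auto
    then have "uniformly_continuous_on (x ` {0..}) g"
      using compact_uniformly_continuous[OF g M] unfolding uniformly_continuous_on_def by (meson subsetD)
    then show "uniformly_continuous_on {0..} (\<lambda>t. g (x t))"
      by (rule uniformly_continuous_on_compose[OF x])
  qed (use nonneg inM in auto)
qed

section \<open>Entries of matrix products and the Frobenius inner product\<close>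

lemma diag_mat_mult_nth:
  "(diag_mat d ** M) $ i $ j = d i * M $ i $ j" "(M ** diag_mat d) $ i $ j = M $ i $ j * d j"
  by (simp_all add: matrix_matrix_mult_def diag_mat_def if_distrib[of "\<lambda>x. x * _"]
      if_distrib[of "\<lambda>x. _ * x"] cong: if_cong)

lemma transpose_nth: "transpose X $ i $ j = X $ j $ i"
  by (simp add: transpose_def)

lemma transpose_diag_mat: "transpose (diag_mat d) = diag_mat d"
  by (auto simp: vec_eq_iff transpose_nth diag_mat_def)

lemma frob_inner_eq_inner: "frob_inner X Y = inner X Y"
  unfolding frob_inner_def trace_def
  by (simp add: matrix_matrix_mult_def transpose_nth inner_vec_def) (rule sum.swap)

lemma inner_matrix_mult_left:
  fixes P X Y :: "'n::finite sqmat"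
  shows "inner (P ** X) Y = inner X (transpose P ** Y)"
  unfolding frob_inner_eq_inner[symmetric] frob_inner_def
  by (simp add: matrix_transpose_mul matrix_mul_assoc)

lemma inner_matrix_entries:
  fixes X Y :: "'n::finite sqmat"
  shows "inner X Y = (\<Sum>i\<in>UNIV. \<Sum>j\<in>UNIV. X $ i $ j * Y $ i $ j)"
  by (simp add: inner_vec_def)

text \<open>Self-adjointness of the two-sided diagonal multiplication. It makes the two product-rule
  terms of the energy derivative equal, whence the factor 2 in
  \<open>energy_has_derivative\<close>.\<close>

lemma inner_sandwich_commute:
  fixes X Y :: "'n::finite sqmat"
  shows "inner (diag_mat a ** X ** diag_mat b) Y = inner (diag_mat a ** Y ** diag_mat b) X"
  by (simp add: inner_matrix_entries diag_mat_mult_nth mult_ac)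

section \<open>Continuity of matrix fields and compactness of the orthogonal group\<close>

lemma continuous_on_matrix_mult [continuous_intros]:
  fixes f g :: "'a::topological_space \<Rightarrow> 'n::finite sqmat"
  assumes "continuous_on U f" "continuous_on U g"
  shows "continuous_on U (\<lambda>x. f x ** g x)"
  unfolding matrix_matrix_mult_def by (intro continuous_intros assms)

lemma continuous_on_transpose [continuous_intros]:
  fixes f :: "'a::topological_space \<Rightarrow> 'n::finite sqmat"
  assumes "continuous_on U f"
  shows "continuous_on U (\<lambda>x. transpose (f x))"
  unfolding transpose_def by (intro continuous_intros assms)

text \<open>Near each point of \<open>M\<close> the map coincides on \<open>M\<close> with a local
  extension, whose \<open>C_on 0\<close> clause is continuity.\<close>

lemma smooth_map_on_imp_continuous_on:
  assumes "smooth_map_on M f" shows "continuous_on M f"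
  unfolding continuous_on_eq_continuous_within
proof
  fix x assume "x \<in> M"
  then obtain U g where U: "open U" "x \<in> U" "C_on 0 U g" "\<forall>y\<in>U \<inter> M. g y = f y"
    using assms unfolding smooth_map_on_def by blast
  then have "continuous (at x) g" by (simp add: continuous_on_eq_continuous_at)
  then have "continuous (at x within M) g" by (rule continuous_at_imp_continuous_at_within)
  moreover have "\<forall>\<^sub>F y in at x within M. g y = f y"
    unfolding eventually_at_topological using U by blast
  moreover have "g x = f x" using U \<open>x \<in> M\<close> by blast
  ultimately show "continuous (at x within M) f"
    unfolding continuous_within using tendsto_cong by fastforce
qed

text \<open>The norm of \<open>real^'n^'n\<close> is the Frobenius norm, so an orthogonal matrix
  satisfies \<open>inner Q Q = trace (mat 1)\<close>, the dimension.\<close>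

lemma compact_orth_group: "compact (orth_group :: 'n::finite sqmat set)"
  unfolding compact_eq_bounded_closed
proof
  have "norm Q \<le> sqrt (real CARD('n))" if "Q \<in> orth_group" for Q :: "'n sqmat"
  proof -
    have "inner Q Q = trace (mat 1 :: 'n sqmat)"
      using that by (simp add: frob_inner_eq_inner[symmetric] frob_inner_def orth_group_def orthogonal_matrix)
    then show ?thesis by (simp add: norm_eq_sqrt_inner trace_I)
  qed
  then show "bounded (orth_group :: 'n sqmat set)" by (auto simp: bounded_iff)
  have "closed {Q :: 'n sqmat. transpose Q ** Q = mat 1}"
    by (intro closed_Collect_eq continuous_intros)
  then show "closed (orth_group :: 'n sqmat set)" by (simp add: orth_group_def orthogonal_matrix)
qed

section \<open>Signed permutation matrices: finiteness and recognition\<close>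

lemma finite_signed_perm_mats: "finite (signed_perm_mats :: 'n::finite sqmat set)"
proof -
  have "signed_perm_mats \<subseteq> (\<lambda>(e, p). diag_mat e ** perm_mat p :: 'n sqmat) `
      ((UNIV \<rightarrow>\<^sub>E {1, - 1}) \<times> UNIV)"
    by (auto simp: signed_perm_mats_def PiE_def image_iff)
  moreover have "finite (UNIV \<rightarrow>\<^sub>E {1, - 1 :: real} :: ('n \<Rightarrow> real) set)"
    by (rule finite_PiE) auto
  ultimately show ?thesis
    by (meson finite_SigmaI finite_UNIV finite_imageI finite_subset finite)
qed

text \<open>Rows have norm 1, so each row \<open>i\<close> has a nonzero entry, in column
  \<open>p i\<close> say. At most one nonzero entry per column makes \<open>p\<close> injective,
  hence bijective; every column is then taken by its own row, and the one remaining entry of each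
  row squares to 1.\<close>

lemma signed_perm_mats_of_monomial:
  fixes Q :: "'n::finite sqmat"
  assumes orth: "Q \<in> orth_group"
    and mono: "\<And>i i' j. \<lbrakk>Q $ i $ j \<noteq> 0; Q $ i' $ j \<noteq> 0\<rbrakk> \<Longrightarrow> i = i'"
  shows "Q \<in> signed_perm_mats"
proof -
  have "Q ** transpose Q = mat 1"
    using orth by (simp add: orth_group_def orthogonal_matrix_def)
  then have row: "(\<Sum>j\<in>UNIV. (Q $ i $ j)\<^sup>2) = 1" for i
    by (simp add: vec_eq_iff matrix_matrix_mult_def transpose_nth mat_def power2_eq_square)
  have "\<exists>j. Q $ i $ j \<noteq> 0" for i
    using row[of i] by (rule_tac ccontr) simp
  then obtain p where p: "\<And>i. Q $ i $ p i \<noteq> 0" by metis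
  have "inj p" by (rule injI) (metis mono p)
  then have surj: "surj p" by (simp add: finite_UNIV_inj_surj)
  have off: "j = p i" if "Q $ i $ j \<noteq> 0" for i j
    using that mono p surj by (metis surjD)
  have "(Q $ i $ p i)\<^sup>2 = 1" for i
  proof -
    have "(\<Sum>j\<in>UNIV. (Q $ i $ j)\<^sup>2) = (\<Sum>j\<in>UNIV. if j = p i then (Q $ i $ p i)\<^sup>2 else 0)"
      by (rule sum.cong) (use off in auto)
    then show ?thesis using row[of i] by simp
  qed
  then have "\<forall>i. Q $ i $ p i = 1 \<or> Q $ i $ p i = - 1" by (simp add: power2_eq_1_iff)
  moreover have "p permutes UNIV" using \<open>inj p\<close> by (intro inj_imp_permutes) auto
  moreover have "Q = diag_mat (\<lambda>i. Q $ i $ p i) ** perm_mat p"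
    unfolding vec_eq_iff by (auto simp: diag_mat_mult_nth perm_mat_def dest: off)
  ultimately show ?thesis unfolding signed_perm_mats_def by blast
qed

text \<open>If \<open>B\<close> is diagonal, then \<open>diag_mat lam ** Q = Q ** B\<close> says
  that the columns of \<open>Q\<close> are eigenvectors of \<open>diag_mat lam\<close>. Its
  eigenvalues are distinct, so each column has only one nonzero entry.\<close>

lemma signed_perm_mats_of_diagonal_conjugate:
  fixes Q :: "'n::finite sqmat"
  assumes orth: "Q \<in> orth_group" and inj: "inj lam"
    and diag: "\<And>i j. i \<noteq> j \<Longrightarrow> (transpose Q ** diag_mat lam ** Q) $ i $ j = 0"
  shows "Q \<in> signed_perm_mats"
proof (rule signed_perm_mats_of_monomial[OF orth])
  define B where "B = transpose Q ** diag_mat lam ** Q"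
  have "Q ** B = (Q ** transpose Q) ** (diag_mat lam ** Q)" by (simp add: B_def matrix_mul_assoc)
  then have eq: "diag_mat lam ** Q = Q ** B"
    using orth by (simp add: orth_group_def orthogonal_matrix_def)
  have "B = diag_mat (\<lambda>i. B $ i $ i)"
    using diag by (auto simp: vec_eq_iff B_def diag_mat_def)
  then obtain b where "B = diag_mat b" by blast
  with eq have "diag_mat lam ** Q = Q ** diag_mat b" by simp
  then have "lam i * Q $ i $ j = Q $ i $ j * b j" for i j
    by (metis diag_mat_mult_nth)
  then have eig: "Q $ i $ j = 0 \<or> lam i = b j" for i j by (metis mult.commute mult_cancel_left)
  fix i i' j assume "Q $ i $ j \<noteq> 0" "Q $ i' $ j \<noteq> 0"
  then show "i = i'" using eig[of i j] eig[of i' j] inj by (auto simp: inj_def)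
qed

section \<open>The two gradient fields in a common form\<close>

text \<open>For the identity as weight this is the commutator of \<open>B\<close> with
  \<open>diag_mat mu\<close>. For \<open>sgn\<close> and decreasing \<open>mu\<close> it is the
  strictly lower triangular part of \<open>B\<close> minus the strictly upper one.\<close>

definition weighted_bracket ::
  "(real \<Rightarrow> real) \<Rightarrow> ('n \<Rightarrow> real) \<Rightarrow> 'n::finite sqmat \<Rightarrow> 'n sqmat" where
  "weighted_bracket \<phi> mu B = (\<chi> i j. \<phi> (mu j - mu i) * B $ i $ j)"

lemma transpose_conjugate_nth:
  "(transpose Q ** diag_mat lam ** Q) $ i $ j = (transpose Q ** diag_mat lam ** Q) $ j $ i"
proof -
  have "transpose (transpose Q ** diag_mat lam ** Q) = transpose Q ** diag_mat lam ** Q"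
    by (simp add: matrix_transpose_mul transpose_diag_mat matrix_mul_assoc)
  then show ?thesis by (metis transpose_nth)
qed

text \<open>Moving \<open>Q\<close> across the inner product leaves twice the pairing of
  \<open>B ** diag_mat mu\<close> with \<open>Om\<close>. A skew \<open>Om\<close> sees only the
  skew part of that product, and as \<open>B\<close> is symmetric, twice this part is the
  commutator.\<close>

lemma energy_derivative_tangent:
  fixes Q Om :: "'n::finite sqmat"
  assumes skew: "Om + transpose Om = 0"
  shows "2 * inner (diag_mat lam ** Q ** diag_mat mu) (Q ** Om) =
    inner (weighted_bracket (\<lambda>x. x) mu (transpose Q ** diag_mat lam ** Q)) Om"
proof -
  define B where "B = transpose Q ** diag_mat lam ** Q"
  have B: "B $ i $ j = B $ j $ i" for i j unfolding B_def by (rule transpose_conjugate_nth)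
  have Om: "Om $ i $ j = - Om $ j $ i" for i j
  proof -
    have "(Om + transpose Om) $ i $ j = 0" unfolding skew by simp
    then show ?thesis by (simp add: transpose_nth)
  qed
  let ?s = "\<Sum>i\<in>UNIV. \<Sum>j\<in>UNIV. B $ i $ j * mu j * Om $ i $ j"
  have "inner (Q ** Om) (diag_mat lam ** Q ** diag_mat mu) = inner Om (B ** diag_mat mu)"
    by (simp only: B_def inner_matrix_mult_left matrix_mul_assoc)
  also have "\<dots> = ?s" by (simp add: inner_matrix_entries diag_mat_mult_nth mult_ac)
  finally have "2 * inner (diag_mat lam ** Q ** diag_mat mu) (Q ** Om) = ?s + ?s"
    by (simp add: inner_commute)
  \<comment> \<open>One of the two copies of \<open>?s\<close> is reindexed by swapping
    \<open>i\<close> and \<open>j\<close>; symmetry of \<open>B\<close> and skewness of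
    \<open>Om\<close> then turn its weight \<open>mu j\<close> into \<open>- mu i\<close>.\<close>
  moreover have "?s = (\<Sum>i\<in>UNIV. \<Sum>j\<in>UNIV. B $ j $ i * mu i * Om $ j $ i)" by (rule sum.swap)
  moreover have "B $ j $ i * mu i * Om $ j $ i = - (B $ i $ j * mu i * Om $ i $ j)" for i j
    using B[of i j] Om[of i j] by simp
  ultimately have "2 * inner (diag_mat lam ** Q ** diag_mat mu) (Q ** Om) =
      ?s + (\<Sum>i\<in>UNIV. \<Sum>j\<in>UNIV. - (B $ i $ j * mu i * Om $ i $ j))" by simp
  also have "\<dots> = inner (weighted_bracket (\<lambda>x. x) mu B) Om"
    by (simp add: inner_matrix_entries weighted_bracket_def algebra_simps
        flip: sum.distrib sum_subtractf)
  finally show ?thesis by (simp add: B_def)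
qed

text \<open>\<open>E_unit j ** B ** E_unit k\<close> isolates the entry at \<open>(j, k)\<close>. As
  \<open>k < j\<close> in the sum, the first terms collect the entries below the diagonal and the
  second ones those above it; since \<open>mu\<close> decreases, the sign of
  \<open>mu b - mu a\<close> records on which side \<open>(a, b)\<close> lies.\<close>

lemma F_field_eq:
  fixes A Q :: "'n::{finite,linorder} sqmat"
  assumes mu: "\<forall>i j. i < j \<longrightarrow> mu i > (mu j :: real)"
  shows "F_field A Q = Q ** weighted_bracket sgn mu (transpose Q ** A ** Q)"
proof -
  define B where "B = transpose Q ** A ** Q"
  have E: "(E_unit j ** X ** E_unit k) $ a $ b = (if a = j \<and> b = k then X $ j $ k else 0)"
    for j k a b :: 'n and X :: "'n sqmat"
  proof -
    have diag: "E_unit l = diag_mat (\<lambda>i. if i = l then 1 else 0)" for l :: 'n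
      by (auto simp: vec_eq_iff E_unit_def diag_mat_def)
    show ?thesis by (simp add: diag diag_mat_mult_nth)
  qed
  have "(\<Sum>j\<in>UNIV. \<Sum>k\<in>{..<j}. E_unit j ** B ** E_unit k - E_unit k ** B ** E_unit j)
      = weighted_bracket sgn mu B" (is "?L = _")
  proof -
    have "?L $ a $ b = weighted_bracket sgn mu B $ a $ b" for a b
    proof -
      have "(\<Sum>k\<in>{..<j}. if a = j \<and> b = k then B $ j $ k else 0) =
          (if j = a then if b < a then B $ a $ b else 0 else 0)"
        "(\<Sum>k\<in>{..<j}. if a = k \<and> b = j then B $ k $ j else 0) =
          (if j = b then if a < b then B $ a $ b else 0 else 0)"
        for j by (auto simp: sum.delta)
      then have "?L $ a $ b = (if b < a then B $ a $ b else 0) - (if a < b then B $ a $ b else 0)"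
        by (simp add: E sum_subtractf)
      moreover have "sgn (mu b - mu a) = (if b < a then 1 else if a < b then - 1 else 0)"
        using mu[rule_format, of a b] mu[rule_format, of b a]
        by (cases a b rule: linorder_cases) auto
      ultimately show ?thesis by (auto simp: weighted_bracket_def)
    qed
    then show ?thesis by (simp add: vec_eq_iff)
  qed
  then show ?thesis by (simp add: F_field_def B_def matrix_mul_assoc)
qed

text \<open>Orthogonality gives \<open>A ** Q = Q ** B\<close>, so \<open>Q\<close> factors out of
  both terms of \<open>H_field\<close> and a commutator remains.\<close>

lemma H_field_eq:
  assumes "Q \<in> orth_group"
  shows "H_field A (diag_mat mu) Q = Q ** weighted_bracket (\<lambda>x. x) mu (transpose Q ** A ** Q)"
proof -
  define B where "B = transpose Q ** A ** Q"
  have "Q ** B = (Q ** transpose Q) ** (A ** Q)" by (simp add: B_def matrix_mul_assoc)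
  then have QB: "A ** Q = Q ** B"
    using assms by (simp add: orth_group_def orthogonal_matrix_def)
  have "B ** diag_mat mu = weighted_bracket (\<lambda>x. x) mu B + diag_mat mu ** B"
    by (simp add: vec_eq_iff weighted_bracket_def diag_mat_mult_nth algebra_simps)
  then have "Q ** (B ** diag_mat mu) =
      Q ** weighted_bracket (\<lambda>x. x) mu B + Q ** (diag_mat mu ** B)"
    by (simp add: matrix_add_ldistrib)
  moreover have "H_field A (diag_mat mu) Q = Q ** (B ** diag_mat mu) - Q ** (diag_mat mu ** B)"
    unfolding H_field_def QB by (simp add: B_def matrix_mul_assoc)
  ultimately show ?thesis by (simp add: B_def)
qed

text \<open>Skewness means that \<open>Q\<close> times the bracket is tangent to the orthogonal
  group at \<open>Q\<close>, so that \<open>energy_derivative_tangent\<close> applies to it.\<close>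

lemma transpose_weighted_bracket:
  assumes "\<And>i j. B $ i $ j = B $ j $ i" and "\<And>x. \<phi> (- x) = - \<phi> x"
  shows "weighted_bracket \<phi> mu B + transpose (weighted_bracket \<phi> mu B) = 0"
proof -
  have "\<phi> (mu j - mu i) * B $ i $ j + \<phi> (mu i - mu j) * B $ j $ i = 0" for i j
    using assms(1)[of i j] assms(2)[of "mu j - mu i"] by simp
  then show ?thesis by (simp add: vec_eq_iff weighted_bracket_def transpose_nth)
qed

lemma inner_weighted_bracket_nonneg:
  assumes "\<And>x. 0 \<le> x * \<phi> x"
  shows "0 \<le> inner (weighted_bracket (\<lambda>x. x) mu B) (weighted_bracket \<phi> mu B)"
  unfolding inner_matrix_entries
proof (intro sum_nonneg)
  fix i j
  have "weighted_bracket (\<lambda>x. x) mu B $ i $ j * weighted_bracket \<phi> mu B $ i $ j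
    = (mu j - mu i) * \<phi> (mu j - mu i) * (B $ i $ j)\<^sup>2"
    by (simp add: weighted_bracket_def power2_eq_square)
  then show "0 \<le> weighted_bracket (\<lambda>x. x) mu B $ i $ j * weighted_bracket \<phi> mu B $ i $ j"
    using assms by simp
qed

text \<open>A vanishing sum of nonnegative terms has only zero terms, and off the diagonal the
  weight is nonzero because the \<open>mu\<close> are distinct.\<close>

lemma inner_weighted_bracket_zero:
  assumes nonneg: "\<And>x. 0 \<le> x * \<phi> x" and zero: "\<And>x. x * \<phi> x = 0 \<Longrightarrow> x = 0" and "inj mu"
    and eq: "inner (weighted_bracket (\<lambda>x. x) mu B) (weighted_bracket \<phi> mu B) = 0" and "i \<noteq> j"
  shows "B $ i $ j = 0"
proof -
  let ?t = "\<lambda>i j. (mu j - mu i) * \<phi> (mu j - mu i) * (B $ i $ j)\<^sup>2"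
  have nn: "0 \<le> ?t i j" for i j using nonneg by simp
  have "(\<Sum>i\<in>UNIV. \<Sum>j\<in>UNIV. ?t i j) = 0"
    using eq by (simp add: inner_matrix_entries weighted_bracket_def power2_eq_square mult_ac)
  then have "(\<Sum>j\<in>UNIV. ?t i j) = 0"
    by (subst (asm) sum_nonneg_eq_0_iff) (use nn in \<open>auto intro: sum_nonneg\<close>)
  then have "?t i j = 0"
    by (subst (asm) sum_nonneg_eq_0_iff) (use nn in auto)
  moreover have "mu j - mu i \<noteq> 0" using \<open>inj mu\<close> \<open>i \<noteq> j\<close> by (auto simp: inj_def)
  ultimately show ?thesis using zero[of "mu j - mu i"] by auto
qed

section \<open>Energy growth and convergence for a general weight\<close>

lemma energy_has_derivative:
  fixes x :: "real \<Rightarrow> 'n::finite sqmat"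
  assumes "(x has_vector_derivative v) (at t within T)"
  shows "((\<lambda>t. inner (diag_mat a ** x t ** diag_mat b) (x t)) has_real_derivative
    2 * inner (diag_mat a ** x t ** diag_mat b) v) (at t within T)"
proof -
  have "linear (\<lambda>X :: 'n sqmat. diag_mat a ** X ** diag_mat b)"
    by (rule linearI) (simp_all add: vec_eq_iff diag_mat_mult_nth algebra_simps)
  then have "bounded_linear (\<lambda>X :: 'n sqmat. diag_mat a ** X ** diag_mat b)"
    by (rule linear_conv_bounded_linear[THEN iffD1])
  from bounded_linear.has_vector_derivative[OF this assms]
  have "((\<lambda>t. inner (diag_mat a ** x t ** diag_mat b) (x t)) has_vector_derivative
    inner (diag_mat a ** x t ** diag_mat b) v + inner (diag_mat a ** v ** diag_mat b) (x t))
    (at t within T)"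
    by (rule bounded_bilinear.has_vector_derivative[OF bounded_bilinear_inner _ assms])
  then show ?thesis
    by (simp add: has_real_derivative_iff_has_vector_derivative inner_sandwich_commute[of a v b "x t"])
qed

text \<open>Treats both systems at once. Oddness of \<open>\<phi>\<close> makes \<open>G\<close>
  tangent, \<open>0 \<le> x * \<phi> x\<close> makes the energy nondecreasing, and
  \<open>zero\<close> confines the zeros of its growth rate to signed permutation matrices.\<close>

lemma llg_solution_tendsto_signed_perm:
  fixes lam mu :: "'n::finite \<Rightarrow> real" and \<phi> :: "real \<Rightarrow> real"
  defines "D \<equiv> \<lambda>X Y. 2 * inner (diag_mat lam ** X ** diag_mat mu) Y"
    and "G \<equiv> \<lambda>X. X ** weighted_bracket \<phi> mu (transpose X ** diag_mat lam ** X)"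
  assumes "inj lam" "inj mu"
    and odd: "\<And>x. \<phi> (- x) = - \<phi> x" and nonneg: "\<And>x. 0 \<le> x * \<phi> x"
    and zero: "\<And>x. x * \<phi> x = 0 \<Longrightarrow> x = 0"
    and S: "continuous_on orth_group S"
    and sol: "is_solution orth_group V Q0 Q"
    and V: "\<And>X. X \<in> orth_group \<Longrightarrow> V X = D X (G X) *\<^sub>R (X ** S X) - D X (X ** S X) *\<^sub>R G X + G X"
  shows "\<exists>Qstar\<in>signed_perm_mats. (Q \<longlongrightarrow> Qstar) at_top"
proof -
  define B where "B X = transpose X ** diag_mat lam ** X" for X :: "'n sqmat"
  have G_cont: "continuous_on orth_group G"
    unfolding G_def weighted_bracket_def by (intro continuous_intros)
  have D_cont: "continuous_on orth_group (\<lambda>X. D X (f X))" if "continuous_on orth_group f" for f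
    unfolding D_def by (intro continuous_intros that)
  have D_G: "D X (G X) = inner (weighted_bracket (\<lambda>x. x) mu (B X)) (weighted_bracket \<phi> mu (B X))" for X
    unfolding D_def G_def B_def
    by (intro energy_derivative_tangent transpose_weighted_bracket transpose_conjugate_nth odd)
  have G_zero: "X \<in> signed_perm_mats" if "X \<in> orth_group" "D X (G X) = 0" for X
    using that(1) \<open>inj lam\<close>
  proof (rule signed_perm_mats_of_diagonal_conjugate)
    fix i j :: 'n assume "i \<noteq> j"
    then show "(transpose X ** diag_mat lam ** X) $ i $ j = 0"
      using inner_weighted_bracket_zero[OF nonneg zero \<open>inj mu\<close>] that(2) unfolding D_G B_def by blast
  qed
  have "\<exists>Z\<in>orth_group. D Z (G Z) = 0 \<and> (Q \<longlongrightarrow> Z) at_top"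
  proof (rule gradient_like_solution_tendsto[OF compact_orth_group sol,
        where f = "\<lambda>X. inner (diag_mat lam ** X ** diag_mat mu) X"])
    show "continuous_on orth_group V"
      by (subst continuous_on_cong[OF refl V])
        (auto intro!: continuous_intros D_cont G_cont S)
    show "continuous_on orth_group (\<lambda>X. inner (diag_mat lam ** X ** diag_mat mu) X)"
      by (intro continuous_intros)
    show "continuous_on orth_group (\<lambda>X. D X (G X))" by (intro D_cont G_cont)
    show "0 \<le> D X (G X)" for X unfolding D_G by (rule inner_weighted_bracket_nonneg[OF nonneg])
    show "finite {X \<in> orth_group. D X (G X) = 0}"
      by (rule finite_subset[OF _ finite_signed_perm_mats]) (use G_zero in auto)
    fix t :: real assume "t \<ge> 0"
    then have t: "Q t \<in> orth_group" "(Q has_vector_derivative V (Q t)) (at t within {0..})"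
      using sol by (auto simp: is_solution_def)
    \<comment> \<open>\<open>D\<close> is linear in its second argument, so the first two terms of
      \<open>V\<close> both contribute the product of \<open>D (G)\<close> and
      \<open>D (Q S)\<close>, with opposite signs; only \<open>G\<close> survives.\<close>
    have "D (Q t) (V (Q t)) = D (Q t) (G (Q t))"
      unfolding V[OF t(1)] by (simp add: D_def inner_add_right inner_diff_right)
    then show "((\<lambda>t. inner (diag_mat lam ** Q t ** diag_mat mu) (Q t)) has_real_derivative
        D (Q t) (G (Q t))) (at t within {0..})"
      using energy_has_derivative[OF t(2), of lam mu] by (simp add: D_def)
  qed
  then show ?thesis using G_zero by blast
qed

section \<open>Reduction of systems (I) and (II) to the general form\<close>

lemma trace_eq_energy_derivative:
  fixes Q X :: "'n::finite sqmat"
  shows "trace (diag_mat mu ** transpose Q ** diag_mat lam ** X) = inner (diag_mat lam ** Q ** diag_mat mu) X"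
  by (simp add: frob_inner_eq_inner[symmetric] frob_inner_def matrix_transpose_mul transpose_diag_mat
      matrix_mul_assoc)

text \<open>This is the gradient property of \<open>H_field\<close>: paired with a tangent vector,
  it yields the derivative of the energy. The factor \<open>Q\<close> cancels by orthogonality,
  leaving the commutator paired with \<open>Om\<close>.\<close>

lemma frob_inner_H_field:
  fixes Q Om :: "'n::finite sqmat"
  assumes "Q \<in> orth_group" and "Om + transpose Om = 0"
  shows "frob_inner (H_field (diag_mat lam) (diag_mat mu) Q) (Q ** Om) =
    2 * inner (diag_mat lam ** Q ** diag_mat mu) (Q ** Om)"
proof -
  have "transpose Q ** (Q ** Om) = Om"
    using assms(1) by (simp add: orth_group_def orthogonal_matrix matrix_mul_assoc)
  then show ?thesis
    unfolding energy_derivative_tangent[OF assms(2)] H_field_eq[OF assms(1)]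
    by (simp only: frob_inner_eq_inner inner_matrix_mult_left)
qed

theorem theorem5p1:
  fixes lam mu :: "'n::{finite,linorder} \<Rightarrow> real"
    and A N Q0 :: "'n sqmat"
    and S :: "'n sqmat \<Rightarrow> 'n sqmat"
    and Q :: "real \<Rightarrow> 'n sqmat"
  assumes lam_decreasing: "\<forall>i j. i < j \<longrightarrow> lam i > lam j"
    and lam_pos: "\<forall>i. lam i > 0"
    and mu_decreasing: "\<forall>i j. i < j \<longrightarrow> mu i > mu j"
    and A: "A = diag_mat lam"
    and N: "N = diag_mat mu"
    and S_smooth: "smooth_map_on orth_group S"
    and S_skew: "\<forall>X\<in>orth_group. S X + transpose (S X) = 0"
    and Q0: "Q0 \<in> orth_group"
    and sol: "is_solution orth_group (system_I A N S) Q0 Q \<or>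
              is_solution orth_group (system_II A N S) Q0 Q"
  shows "\<exists>Qstar \<in> signed_perm_mats. (Q \<longlongrightarrow> Qstar) at_top"
proof -
  have inj: "inj lam" "inj mu"
    using lam_decreasing mu_decreasing by (metis injI linorder_neqE order_less_irrefl)+
  note S = smooth_map_on_imp_continuous_on[OF S_smooth]
  show ?thesis
    using sol
  proof
    assume sol: "is_solution orth_group (system_I A N S) Q0 Q"
    show ?thesis
    proof (rule llg_solution_tendsto_signed_perm[where \<phi> = sgn, OF inj _ _ _ S sol])
      show "system_I A N S X = (2 * inner (diag_mat lam ** X ** diag_mat mu)
            (X ** weighted_bracket sgn mu (transpose X ** diag_mat lam ** X))) *\<^sub>R (X ** S X)
          - (2 * inner (diag_mat lam ** X ** diag_mat mu) (X ** S X)) *\<^sub>R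
            (X ** weighted_bracket sgn mu (transpose X ** diag_mat lam ** X))
          + X ** weighted_bracket sgn mu (transpose X ** diag_mat lam ** X)" for X
      proof -
        have "trace (diag_mat mu ** transpose X ** diag_mat lam ** X ** S X) =
            inner (diag_mat lam ** X ** diag_mat mu) (X ** S X)"
          unfolding trace_eq_energy_derivative[symmetric] by (simp only: matrix_mul_assoc)
        then show ?thesis
          unfolding system_I_def A N F_field_eq[OF mu_decreasing] trace_eq_energy_derivative
          by (simp only:)
      qed
    qed (auto simp: sgn_if split: if_splits)
  next
    assume sol: "is_solution orth_group (system_II A N S) Q0 Q"
    show ?thesis
    proof (rule llg_solution_tendsto_signed_perm[where \<phi> = "\<lambda>x. x", OF inj _ _ _ S sol])
      fix X :: "'n sqmat" assume X: "X \<in> orth_group"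
      let ?W = "weighted_bracket (\<lambda>x. x) mu (transpose X ** diag_mat lam ** X)"
      have H: "H_field A N X = X ** ?W" unfolding A N by (rule H_field_eq[OF X])
      have D: "frob_inner (H_field A N X) (X ** Om) =
          2 * inner (diag_mat lam ** X ** diag_mat mu) (X ** Om)" if "Om + transpose Om = 0" for Om
        unfolding A N using X that by (rule frob_inner_H_field)
      have "?W + transpose ?W = 0"
        by (intro transpose_weighted_bracket transpose_conjugate_nth) simp
      \<comment> \<open>\<open>H_field\<close> is itself the tangent vector \<open>X ** ?W\<close>,
        so its squared norm is its pairing with a tangent vector and hence an energy
        derivative.\<close>
      moreover have "(frob_norm (H_field A N X))\<^sup>2 = frob_inner (H_field A N X) (X ** ?W)"
        unfolding H frob_norm_def frob_inner_eq_inner by (intro real_sqrt_pow2 inner_ge_zero)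
      ultimately have "(frob_norm (H_field A N X))\<^sup>2 =
          2 * inner (diag_mat lam ** X ** diag_mat mu) (X ** ?W)"
        using D by simp
      then show "system_II A N S X =
          (2 * inner (diag_mat lam ** X ** diag_mat mu) (X ** ?W)) *\<^sub>R (X ** S X)
          - (2 * inner (diag_mat lam ** X ** diag_mat mu) (X ** S X)) *\<^sub>R (X ** ?W) + X ** ?W"
        unfolding system_II_def using D S_skew X by (simp add: H)
    qed auto
  qed
qed

end
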